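(* Let $f:\mathbb{R}^n\to\mathbb{R}$ be a $\mathcal{C}^1$-smooth function with a globally Lipschitz continuous gradient, let $\bar x\in\mathbb{R}^n$, and let $\Delta>0$. Assume that $\bar x$ is a local minimizer of $f$ satisfying the KL property at $\bar x$ (i.e., $f$ satisfies the KL property at $\bar x$), and that the iterates $x^k$ generated by Algorithm DFC (described in the context) satisfy $\nabla f(x^k)\ne0$ for all $k\in\mathbb{N}$. Then there exist $\xi,C>0$ such that for any initial point $x^1\in\mathbb{B}(\bar x,\xi)$, any initial sampling radius $\delta_1\in(0,\Delta]$, any $C_1\ge C$ and other parameters listed in Algorithm DFC, the sequence $\{x^k\}$ generated by Algorithm DFC converges to a local minimizer $\tilde x$ of $f$ with $f(\tilde x)=f(\bar x)$. The following convergence rates are guaranteed if $f$ satisfies the KL property at $\bar x$ with $\psi(t)=Mt^q$, $M>0$, and $q\in(0,1)$: - If $q\in(0,1/2]$, the sequences $\{x^k\}$, $\{\nabla f(x^k)\}$, and $\{f(x^k)\}$ converge linearly as $k\to\infty$ to $\tilde x$, $0\in\mathbb{R}^n$, and $f(\bar x)$, respectively. - If $q\in(1/2,1)$, then $\|x^k-\tilde x\|=\mathcal{O}\big(k^{-\frac{1-q}{2q-1}}\big)$, $\|\nabla f(x^k)\|=\mathcal{O}\big(k^{-\frac{1-q}{2q-1}}\big)$, and $f(x^k)-f(\bar x)=\mathcal{O}\big(k^{-\frac{2-2q}{2q-1}}\big)$ as $k\to\infty$.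
   Context: $\|\cdot\|$ is the Euclidean norm on $\mathbb{R}^n$, $\mathbb{N}=\{1,2,\dots\}$, and $\mathbb{B}(x,\varepsilon)$ is the open ball of center $x$ and radius $\varepsilon$. Global Lipschitz continuity of $\nabla f$ means that there is $L>0$ with $\|\nabla f(x)-\nabla f(y)\|\le L\|x-y\|$ for all $x,y\in\mathbb{R}^n$. Global approximation: a mapping $\mathcal{G}:\mathbb{R}^n\times(0,\infty)\to\mathbb{R}^n$ is a global approximation of $\nabla f$ if there is a constant $C'>0$ such that $\|\mathcal{G}(x,\delta)-\nabla f(x)\|\le C'\delta$ for all $(x,\delta)\in\mathbb{R}^n\times(0,\infty)$. Algorithm DFC (Derivative-Free method with Constant stepsize). Step 0: Choose a global approximation $\mathcal{G}$ of $\nabla f$. Select an initial point $x^1\in\mathbb{R}^n$, an initial sampling radius $\delta_1>0$, a constant $C_1>0$, a reduction factor $\theta\in(0,1)$, and scaling factors $\mu>2$, $r>1$, $\kappa>0$. Set $k:=1$. Step 1: Find $g^k$ and the smallest nonnegative integer $i_k$ such that $g^k=\mathcal{G}(x^k,\theta^{i_k}\delta_k)$ and $\|g^k\|>\mu C_k\theta^{i_k}\delta_k$ (such $g^k,i_k$ exist whenever $\nabla f(x^k)\ne0$). Then set $\delta_{k+1}:=\theta^{i_k}\delta_k$. Step 2: If $f\big(x^k-\frac{\kappa}{C_k}g^k\big)\le f(x^k)-\frac{\kappa(\mu-2)}{2C_k\mu}\|g^k\|^2$, then $x^{k+1}:=x^k-\frac{\kappa}{C_k}g^k$ and $C_{k+1}:=C_k$.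 Otherwise, $x^{k+1}:=x^k$ and $C_{k+1}:=rC_k$. Increase $k$ by $1$ and go back to Step 1. KL property: a differentiable $f:\mathbb{R}^n\to\mathbb{R}$ satisfies the KL property at $\bar x$ if there exist a number $\eta>0$, a neighborhood $U$ of $\bar x$, and a nondecreasing function $\psi:(0,\eta)\to(0,\infty)$ such that $1/\psi$ is integrable over $(0,\eta)$ and $\|\nabla f(x)\|\ge\psi\big(f(x)-f(\bar x)\big)$ for all $x\in U$ with $f(\bar x)<f(x)<f(\bar x)+\eta$. "With $\psi(t)=Mt^q$" means that this property holds with that particular $\psi$ for some $\eta$ and $U$. A sequence $\{z^k\}$ converges linearly to $z$ if there are $c>0$ and $\rho\in(0,1)$ with $\|z^k-z\|\le c\rho^k$ for all sufficiently large $k$.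
   Formalization: The threshold C may depend on κ and on the constant C' of the approximation G (with C chosen before them the claim fails); the function ψ of the KL property is fixed before ξ and C, and the rates are stated for that ψ when ψ(t)=Mt^q. *)

theory Defs
  imports "HOL-Analysis.Analysis" "HOL-Library.Landau_Symbols"
begin

text \<open>Throughout, \<open>gf\<close> stands for the gradient of \<open>f\<close>.\<close>

definition C1_with_Lipschitz_gradient :: "(real ^ 'n \<Rightarrow> real) \<Rightarrow> (real ^ 'n \<Rightarrow> real ^ 'n) \<Rightarrow> bool" where
  "C1_with_Lipschitz_gradient f gf \<longleftrightarrow>
     (\<forall>x. GDERIV f x :> gf x) \<and> continuous_on UNIV gf \<and> (\<exists>L>0. L-lipschitz_on UNIV gf)"

definition local_minimizer :: "(real ^ 'n \<Rightarrow> real) \<Rightarrow> real ^ 'n \<Rightarrow> bool" where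
  "local_minimizer f x \<longleftrightarrow> (\<exists>\<epsilon>>0. \<forall>y\<in>ball x \<epsilon>. f x \<le> f y)"

text \<open>The constant \<open>C'\<close> of the approximation is an explicit argument; a global approximation of
  \<open>gf\<close> is a \<open>G\<close> for which this holds for some \<open>C'\<close>. Values \<open>G x \<delta>\<close> with \<open>\<delta> \<le> 0\<close> are irrelevant.\<close>

definition global_approximation ::
    "real \<Rightarrow> (real ^ 'n \<Rightarrow> real ^ 'n) \<Rightarrow> (real ^ 'n \<Rightarrow> real \<Rightarrow> real ^ 'n) \<Rightarrow> bool" where
  "global_approximation C' gf G \<longleftrightarrow> C' > 0 \<and> (\<forall>x. \<forall>\<delta>>0. norm (G x \<delta> - gf x) \<le> C' * \<delta>)"

text \<open>The KL property at \<open>xb\<close> with a given \<open>\<psi>\<close>; only the values of \<open>\<psi>\<close> on some interval \<open>(0,\<eta>)\<close>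
  matter. The KL property itself is the existence of such a \<open>\<psi>\<close>.\<close>

definition KL_property_with ::
    "(real \<Rightarrow> real) \<Rightarrow> (real ^ 'n \<Rightarrow> real) \<Rightarrow> (real ^ 'n \<Rightarrow> real ^ 'n) \<Rightarrow> real ^ 'n \<Rightarrow> bool" where
  "KL_property_with \<psi> f gf xb \<longleftrightarrow>
     (\<exists>\<eta>>0. \<exists>U. open U \<and> xb \<in> U \<and>
        (\<forall>t\<in>{0<..<\<eta>}. \<psi> t > 0) \<and>
        mono_on {0<..<\<eta>} \<psi> \<and>
        set_integrable lborel {0<..<\<eta>} (\<lambda>t. 1 / \<psi> t) \<and>
        (\<forall>x\<in>U. f xb < f x \<and> f x < f xb + \<eta> \<longrightarrow> norm (gf x) \<ge> \<psi> (f x - f xb)))"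

text \<open>\<open>DFC_run f G \<theta> \<mu> r \<kappa> x g i \<delta> C\<close>: the sequences form an infinite run of Algorithm DFC. They are
  indexed from 1, so their values at 0 are unconstrained. The initial data are
  \<open>x 1\<close>, \<open>\<delta> 1\<close> and \<open>C 1\<close>.\<close>

definition DFC_run ::
    "(real ^ 'n \<Rightarrow> real) \<Rightarrow> (real ^ 'n \<Rightarrow> real \<Rightarrow> real ^ 'n) \<Rightarrow> real \<Rightarrow> real \<Rightarrow> real \<Rightarrow> real \<Rightarrow>
     (nat \<Rightarrow> real ^ 'n) \<Rightarrow> (nat \<Rightarrow> real ^ 'n) \<Rightarrow> (nat \<Rightarrow> nat) \<Rightarrow> (nat \<Rightarrow> real) \<Rightarrow> (nat \<Rightarrow> real) \<Rightarrow> bool" where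
  "DFC_run f G \<theta> \<mu> r \<kappa> x g i \<delta> C \<longleftrightarrow>
     0 < \<theta> \<and> \<theta> < 1 \<and> \<mu> > 2 \<and> r > 1 \<and> \<kappa> > 0 \<and> \<delta> 1 > 0 \<and> C 1 > 0 \<and>
     (\<forall>k\<ge>1.
        g k = G (x k) (\<theta> ^ i k * \<delta> k) \<and>
        norm (g k) > \<mu> * C k * \<theta> ^ i k * \<delta> k \<and>
        (\<forall>j<i k. \<not> norm (G (x k) (\<theta> ^ j * \<delta> k)) > \<mu> * C k * \<theta> ^ j * \<delta> k) \<and>
        \<delta> (k + 1) = \<theta> ^ i k * \<delta> k \<and>
        (if f (x k - (\<kappa> / C k) *\<^sub>R g k) \<le> f (x k) - \<kappa> * (\<mu> - 2) / (2 * C k * \<mu>) * (norm (g k))\<^sup>2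
         then x (k + 1) = x k - (\<kappa> / C k) *\<^sub>R g k \<and> C (k + 1) = C k
         else x (k + 1) = x k \<and> C (k + 1) = r * C k))"

definition converges_linearly :: "(nat \<Rightarrow> 'a::real_normed_vector) \<Rightarrow> 'a \<Rightarrow> bool" where
  "converges_linearly z l \<longleftrightarrow>
     (\<exists>c>0. \<exists>\<rho>. 0 < \<rho> \<and> \<rho> < 1 \<and> (\<forall>\<^sub>F k in sequentially. norm (z k - l) \<le> c * \<rho> ^ k))"

end

theory Submission
  imports Defs
begin

text \<open>
  Let \<open>C 1 \<ge> max C' (2 * L * \<kappa>)\<close>, where \<open>L\<close> is a Lipschitz constant of the gradient. The test
  \<open>norm (g k) > \<mu> * C k * \<delta> (k + 1)\<close> bounds the error of \<open>g k\<close> by \<open>norm (g k) / \<mu>\<close>, and for a step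
  of length \<open>\<tau> = \<kappa> / C 1 \<le> 1 / (2 * L)\<close> this error is harmless: every step is accepted, \<open>C\<close> never
  changes, and the run is gradient descent with constant step length and a relative error below
  \<open>1 / 2\<close> in the gradient
  (\<open>dfc_large_initial_C_accepts\<close>). The decrease that the algorithm demands degenerates as \<open>\<mu>\<close> tends
  to 2, but the decrease that it achieves does not: it is at least \<open>\<tau> / 4 * (norm (g k))\<^sup>2\<close>. This is
  what makes a radius \<open>\<xi>\<close> possible that is independent of the parameters. It yields the strong
  descent inequality
  \<open>norm (gf (x k)) * norm (x (k + 1) - x k) \<le> 6 * (f (x k) - f (x (k + 1)))\<close>,
  whose constant involves neither \<open>\<tau>\<close> nor \<open>\<mu>\<close> (\<open>short_inexact_step_bounds\<close>).

  Let \<open>v k = f (x k) - f xb\<close>, and let \<open>\<Phi>\<close> be the integral of \<open>1 / \<psi>\<close> from 0. As \<open>\<psi>\<close> is nondecreasing,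
  \<open>v k - v (k + 1) \<le> \<psi> (v k) * (\<Phi> (v k) - \<Phi> (v (k + 1)))\<close>; combined with strong descent and
  with \<open>\<psi> (v k) \<le> norm (gf (x k))\<close>, this bounds the length of the step by
  \<open>6 * (\<Phi> (v k) - \<Phi> (v (k + 1)))\<close>. The bounds telescope, so that the whole trajectory has length at
  most \<open>6 * \<Phi> (v 1)\<close>, which is small if \<open>x 1\<close> is near \<open>xb\<close>, because \<open>\<Phi>\<close> tends to 0 at 0. The iterates
  therefore never leave the ball on which \<open>f xb\<close> is minimal and the inequality for \<open>\<psi>\<close> holds
  (\<open>kl_descent_trapped\<close>), and they converge. The limit is critical, and the inequality for \<open>\<psi>\<close>
  excludes critical points with a value slightly above \<open>f xb\<close>; so the limit has the value \<open>f xb\<close>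
  (\<open>kl_descent_converges\<close>) and, lying in the same ball, is itself a local minimizer.

  For \<open>\<psi> t = M * t powr q\<close>, sufficient decrease gives the recursion
  \<open>a * v k powr (2 * q) \<le> v k - v (k + 1)\<close>. If \<open>2 * q \<le> 1\<close>, then \<open>v\<close> eventually contracts by a
  constant factor; otherwise \<open>v k powr (1 - 2 * q)\<close> grows at least linearly. The tail of the
  trajectory is bounded by a multiple of \<open>v k powr (1 - q)\<close>, and the gradient is bounded by \<open>L\<close>
  times the distance to the limit (\<open>power_kl_rates\<close>).
\<close>

section \<open>Gradient steps with a relative error\<close>

text \<open>
  Along the segment from \<open>x\<close> to \<open>x + d\<close>, the difference of the two sides is monotone: its
  derivative is controlled by the Cauchy--Schwarz inequality and the Lipschitz bound.
\<close>

lemma lipschitz_gradient_upper_bound: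
  fixes f :: "'a::real_inner \<Rightarrow> real"
  assumes grad: "\<And>x. GDERIV f x :> gf x" and lip: "L-lipschitz_on UNIV gf"
  shows "f (x + d) \<le> f x + inner (gf x) d + L / 2 * (norm d)\<^sup>2"
proof -
  define h where "h = (\<lambda>t::real. f (x + t *\<^sub>R d) - t * inner (gf x) d - L * t\<^sup>2 / 2 * (norm d)\<^sup>2)"
  have deriv: "DERIV h t :> inner d (gf (x + t *\<^sub>R d)) - inner (gf x) d - L * t * (norm d)\<^sup>2" for t
  proof -
    have "((\<lambda>t. x + t *\<^sub>R d) has_derivative (\<lambda>s. s *\<^sub>R d)) (at t)"
      by (auto intro!: derivative_eq_intros)
    then have "((\<lambda>t. f (x + t *\<^sub>R d)) has_derivative (\<lambda>s. inner (s *\<^sub>R d) (gf (x + t *\<^sub>R d)))) (at t)"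
      using has_derivative_compose grad unfolding gderiv_def by blast
    then have "((\<lambda>t. f (x + t *\<^sub>R d)) has_real_derivative inner d (gf (x + t *\<^sub>R d))) (at t)"
      by (simp add: has_field_derivative_def mult_commute_abs)
    then show ?thesis
      unfolding h_def by (auto intro!: derivative_eq_intros)
  qed
  have "h 1 \<le> h 0"
  proof (rule DERIV_nonpos_imp_nonincreasing[of 0 1 h])
    fix t :: real assume t: "0 \<le> t" "t \<le> 1"
    have "inner d (gf (x + t *\<^sub>R d)) - inner (gf x) d = inner d (gf (x + t *\<^sub>R d) - gf x)"
      by (simp add: inner_diff_right inner_commute)
    also have "\<dots> \<le> norm d * norm (gf (x + t *\<^sub>R d) - gf x)"
      by (rule norm_cauchy_schwarz)
    also have "\<dots> \<le> norm d * (L * (t * norm d))"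
      using lipschitz_onD[OF lip, of "x + t *\<^sub>R d" x] t
      by (intro mult_left_mono) (auto simp: dist_norm)
    finally have "inner d (gf (x + t *\<^sub>R d)) - inner (gf x) d - L * t * (norm d)\<^sup>2 \<le> 0"
      by (simp add: power2_eq_square mult_ac)
    with deriv show "\<exists>y. DERIV h t :> y \<and> y \<le> 0" by blast
  qed simp
  then show ?thesis by (simp add: h_def)
qed

lemma gradient_zero_at_local_minimizer:
  assumes grad: "GDERIV f x :> d" and min: "local_minimizer f x"
  shows "d = 0"
proof -
  obtain e where e: "e > 0" "\<forall>y\<in>ball x e. f x \<le> f y"
    using min unfolding local_minimizer_def by blast
  have "(\<lambda>h. inner h d) = (\<lambda>h. 0)"
    using differential_zero_maxmin[of x "ball x e" f "\<lambda>h. inner h d"] grad e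
    by (auto simp: gderiv_def)
  then have "inner d d = 0" by metis
  then show ?thesis by simp
qed

text \<open>
  An error of at most \<open>s * norm g\<close> still forces \<open>inner (gf x) g \<ge> (1 - s) * (norm g)\<^sup>2\<close>, so that
  \<open>- g\<close> is a descent direction for \<open>s < 1\<close>.
\<close>

lemma inexact_gradient_step_decrease:
  fixes f :: "'a::real_inner \<Rightarrow> real"
  assumes grad: "\<And>x. GDERIV f x :> gf x" and lip: "L-lipschitz_on UNIV gf"
    and err: "norm (g - gf x) \<le> s * norm g" and t: "0 \<le> t"
  shows "f (x - t *\<^sub>R g) \<le> f x - t * (1 - s - L * t / 2) * (norm g)\<^sup>2"
proof -
  have "inner (g - gf x) g \<le> norm (g - gf x) * norm g"
    by (rule norm_cauchy_schwarz)
  also have "\<dots> \<le> s * norm g * norm g"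
    using err by (rule mult_right_mono) simp
  finally have "(1 - s) * (norm g)\<^sup>2 \<le> inner (gf x) g"
    by (simp add: inner_diff_left power2_norm_eq_inner[symmetric] power2_eq_square left_diff_distrib)
  then have "t * ((1 - s) * (norm g)\<^sup>2) \<le> t * inner (gf x) g"
    using t by (rule mult_left_mono)
  moreover have "f (x - t *\<^sub>R g) \<le> f x - t * inner (gf x) g + L / 2 * t\<^sup>2 * (norm g)\<^sup>2"
    using lipschitz_gradient_upper_bound[OF grad lip, of x "- (t *\<^sub>R g)"]
    by (simp add: power_mult_distrib mult_ac)
  ultimately show ?thesis by (simp add: algebra_simps power2_eq_square)
qed

text \<open>
  The inner loop stops only when \<open>norm (g k)\<close> exceeds \<open>\<mu> * C 1\<close> times the sampling radius, and
  \<open>C 1 \<ge> C'\<close> turns this into the relative error \<open>1 / \<mu>\<close>. The decrease coefficient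
  \<open>1 - 1 / \<mu> - L * \<kappa> / (2 * C 1)\<close> is then at least \<open>1 / 2 - 1 / \<mu>\<close>, the one that the algorithm
  asks for. An accepted step leaves \<open>C\<close> unchanged, so the argument repeats.
\<close>

lemma dfc_large_initial_C_accepts:
  assumes grad: "\<And>x. GDERIV f x :> gf x" and lip: "L-lipschitz_on UNIV gf"
    and approx: "global_approximation C' gf G"
    and run: "DFC_run f G \<theta> \<mu> r \<kappa> x g i \<delta> C"
    and C1: "C' \<le> C 1" "L * \<kappa> \<le> C 1" and k: "k \<ge> 1"
  shows "C k = C 1" "norm (g k - gf (x k)) \<le> 1 / \<mu> * norm (g k)"
    "x (Suc k) = x k - (\<kappa> / C 1) *\<^sub>R g k"
proof -
  have par: "0 < \<theta>" "\<mu> > 2" "\<kappa> > 0" "C 1 > 0"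
    using run unfolding DFC_run_def by auto
  have loop: "g k = G (x k) (\<theta> ^ i k * \<delta> k) \<and> norm (g k) > \<mu> * C k * \<theta> ^ i k * \<delta> k \<and>
      \<delta> (Suc k) = \<theta> ^ i k * \<delta> k \<and>
      (if f (x k - (\<kappa> / C k) *\<^sub>R g k) \<le> f (x k) - \<kappa> * (\<mu> - 2) / (2 * C k * \<mu>) * (norm (g k))\<^sup>2
       then x (Suc k) = x k - (\<kappa> / C k) *\<^sub>R g k \<and> C (Suc k) = C k
       else x (Suc k) = x k \<and> C (Suc k) = r * C k)" if "k \<ge> 1" for k
    using run that unfolding DFC_run_def by auto
  have step: "norm (g k - gf (x k)) \<le> 1 / \<mu> * norm (g k) \<and>
      x (Suc k) = x k - (\<kappa> / C 1) *\<^sub>R g k \<and> C (Suc k) = C 1"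
    if k: "k \<ge> 1" and d: "\<delta> k > 0" and C: "C k = C 1" for k
  proof -
    define \<epsilon> where "\<epsilon> = \<theta> ^ i k * \<delta> k"
    have \<epsilon>: "\<epsilon> > 0" using d par by (simp add: \<epsilon>_def)
    have "norm (g k - gf (x k)) \<le> C' * \<epsilon>"
      using approx loop[OF k] \<epsilon> unfolding global_approximation_def \<epsilon>_def by auto
    also have "\<dots> \<le> C 1 * \<epsilon>" using C1 \<epsilon> by simp
    also have "\<dots> \<le> norm (g k) / \<mu>"
    proof -
      have "\<mu> * C k * \<theta> ^ i k * \<delta> k < norm (g k)"
        using loop[OF k] by blast
      then have "\<mu> * (C 1 * \<epsilon>) \<le> norm (g k)"
        using C by (simp add: \<epsilon>_def mult_ac)
      then show ?thesis using par by (simp add: pos_le_divide_eq mult.commute)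
    qed
    finally have err: "norm (g k - gf (x k)) \<le> 1 / \<mu> * norm (g k)" by simp
    have "(\<mu> - 2) / (2 * \<mu>) \<le> 1 - 1 / \<mu> - L * (\<kappa> / C 1) / 2"
      using C1 par by (simp add: field_simps)
    then have "\<kappa> / C 1 * ((\<mu> - 2) / (2 * \<mu>)) * (norm (g k))\<^sup>2
        \<le> \<kappa> / C 1 * (1 - 1 / \<mu> - L * (\<kappa> / C 1) / 2) * (norm (g k))\<^sup>2"
      using par by (intro mult_right_mono mult_left_mono) auto
    moreover have "\<kappa> / C 1 * ((\<mu> - 2) / (2 * \<mu>)) = \<kappa> * (\<mu> - 2) / (2 * C 1 * \<mu>)" by simp
    moreover have "f (x k - (\<kappa> / C 1) *\<^sub>R g k)
        \<le> f (x k) - \<kappa> / C 1 * (1 - 1 / \<mu> - L * (\<kappa> / C 1) / 2) * (norm (g k))\<^sup>2"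
      using inexact_gradient_step_decrease[OF grad lip err, of "\<kappa> / C 1"] par by simp
    ultimately have "f (x k - (\<kappa> / C k) *\<^sub>R g k)
        \<le> f (x k) - \<kappa> * (\<mu> - 2) / (2 * C k * \<mu>) * (norm (g k))\<^sup>2"
      using C by simp
    with loop[OF k] C err show ?thesis by simp
  qed
  have inv: "\<delta> k > 0 \<and> C k = C 1" using k
  proof (induction k rule: nat_induct_at_least)
    case base
    show ?case using run unfolding DFC_run_def by simp
  next
    case (Suc k)
    then show ?case using step[of k] loop[of k] par by simp
  qed
  with step[OF k] show "C k = C 1" "norm (g k - gf (x k)) \<le> 1 / \<mu> * norm (g k)"
    "x (Suc k) = x k - (\<kappa> / C 1) *\<^sub>R g k" by auto
qed

text \<open>
  With error at most \<open>norm g / 2\<close>, the norms of \<open>g\<close> and of the true gradient agree up to constant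
  factors. The first bound is strong descent: it ties the decrease to the product of the gradient
  norm and the step length, and no longer mentions \<open>t\<close>. The last bound keeps a single step from
  leaving a ball of twice the radius, which is needed before anything is known about the value of
  \<open>f\<close> at the new point.
\<close>

lemma short_inexact_step_bounds:
  fixes f :: "'a::real_inner \<Rightarrow> real"
  assumes grad: "\<And>x. GDERIV f x :> gf x" and lip: "L-lipschitz_on UNIV gf"
    and err: "norm (g - gf x) \<le> norm g / 2" and t: "0 < t" "2 * L * t \<le> 1"
    and y: "y = x - t *\<^sub>R g"
  shows "norm (gf x) * norm (y - x) \<le> 6 * (f x - f y)"
    and "t / 9 * (norm (gf x))\<^sup>2 \<le> f x - f y"
    and "gf z = 0 \<Longrightarrow> norm (y - x) \<le> norm (x - z)"
proof -
  have up: "norm (gf x) \<le> 3 / 2 * norm g"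
    using norm_triangle_sub[of "gf x" g] err by (simp add: norm_minus_commute)
  have lo: "norm g \<le> 2 * norm (gf x)"
    using norm_triangle_sub[of g "gf x"] err by simp
  have step: "norm (y - x) = t * norm g" using t y by simp
  have "1 / 4 \<le> 1 - 1 / 2 - L * t / 2" using t by simp
  then have "t * (1 / 4) * (norm g)\<^sup>2 \<le> t * (1 - 1 / 2 - L * t / 2) * (norm g)\<^sup>2"
    using t by (intro mult_right_mono mult_left_mono) auto
  also have "\<dots> \<le> f x - f y"
    using inexact_gradient_step_decrease[OF grad lip, of g x "1 / 2" t] err t y by simp
  finally have dec: "t / 4 * (norm g)\<^sup>2 \<le> f x - f y" by simp
  have "norm (gf x) * norm (y - x) \<le> 3 / 2 * norm g * (t * norm g)"
    unfolding step using up t by (intro mult_right_mono) auto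
  then show "norm (gf x) * norm (y - x) \<le> 6 * (f x - f y)"
    using dec by (simp add: power2_eq_square mult_ac)
  have "t / 9 * (norm (gf x))\<^sup>2 \<le> t / 9 * (3 / 2 * norm g)\<^sup>2"
    using up t by (intro mult_left_mono power_mono) auto
  then show "t / 9 * (norm (gf x))\<^sup>2 \<le> f x - f y"
    using dec by (simp add: power2_eq_square)
  assume z: "gf z = 0"
  have "norm (y - x) \<le> t * (2 * norm (gf x))"
    unfolding step using lo t by (intro mult_left_mono) auto
  also have "\<dots> \<le> t * (2 * (L * norm (x - z)))"
    using lipschitz_onD[OF lip, of x z] t z by (intro mult_left_mono) (auto simp: dist_norm)
  also have "\<dots> = 2 * L * t * norm (x - z)" by simp
  also have "\<dots> \<le> norm (x - z)" using t(2) by (intro mult_left_le_one_le)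
      (use t lipschitz_on_nonneg[OF lip] in auto)
  finally show "norm (y - x) \<le> norm (x - z)" .
qed

section \<open>Desingularizing functions\<close>

text \<open>
  For differentiable \<open>\<Phi>\<close> this is the integrated form of \<open>1 \<le> \<psi> s * \<Phi>' s\<close> for nondecreasing \<open>\<psi>\<close>.
  Stated without derivatives, it also covers the integral of \<open>1 / \<psi>\<close> when \<open>\<psi>\<close> is discontinuous.
\<close>

definition desingularizes :: "(real \<Rightarrow> real) \<Rightarrow> (real \<Rightarrow> real) \<Rightarrow> real \<Rightarrow> bool" where
  "desingularizes \<Phi> \<psi> \<eta> \<longleftrightarrow>
     (\<forall>s t. 0 < t \<and> t \<le> s \<and> s < \<eta> \<longrightarrow> s - t \<le> \<psi> s * (\<Phi> s - \<Phi> t))"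

text \<open>
  On \<open>{t<..s}\<close> the integrand is at least \<open>1 / \<psi> s\<close>, because \<open>\<psi>\<close> is nondecreasing. The limit makes
  \<open>\<Phi>\<close> arbitrarily small near 0, which is where the integrability of \<open>1 / \<psi>\<close> up to 0 enters.
\<close>

lemma integral_desingularizes:
  fixes \<psi> :: "real \<Rightarrow> real"
  assumes pos: "\<And>t. t \<in> {0<..<\<eta>} \<Longrightarrow> \<psi> t > 0" and mono: "mono_on {0<..<\<eta>} \<psi>"
    and int: "set_integrable lborel {0<..<\<eta>} (\<lambda>t. 1 / \<psi> t)"
  defines "\<Phi> \<equiv> \<lambda>s. LINT t:{0<..s}|lborel. 1 / \<psi> t"
  shows "desingularizes \<Phi> \<psi> \<eta>" and "\<And>s. s < \<eta> \<Longrightarrow> 0 \<le> \<Phi> s"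
    and "\<eta> > 0 \<Longrightarrow> (\<lambda>n. \<Phi> (\<eta> / real (n + 2))) \<longlonglongrightarrow> 0"
proof -
  have sub: "set_integrable lborel A (\<lambda>t. 1 / \<psi> t)" if "A \<subseteq> {0<..<\<eta>}" "A \<in> sets lborel" for A
    using set_integrable_subset[OF int that(2,1)] .
  show "desingularizes \<Phi> \<psi> \<eta>"
    unfolding desingularizes_def
  proof (intro allI impI, elim conjE)
    fix s t assume st: "0 < t" "t \<le> s" "s < \<eta>"
    have "{0<..s} = {0<..t} \<union> {t<..s}" using st by auto
    then have split: "\<Phi> s = \<Phi> t + (LINT u:{t<..s}|lborel. 1 / \<psi> u)"
      unfolding \<Phi>_def using st by (simp, intro set_integral_Un sub) auto
    have fin: "set_integrable lborel {t<..s} (\<lambda>u. 1 / \<psi> s)"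
      unfolding set_integrable_def using st by (intro integrable_scaleR_left integrable_real_indicator) auto
    have "(s - t) * (1 / \<psi> s) = (LINT u:{t<..s}|lborel. 1 / \<psi> s)"
      using st by (subst set_integral_const) auto
    also have "\<dots> \<le> (LINT u:{t<..s}|lborel. 1 / \<psi> u)"
    proof (rule set_integral_mono[OF fin sub])
      fix u assume u: "u \<in> {t<..s}"
      have "0 < \<psi> u" using u st by (intro pos) auto
      moreover have "\<psi> u \<le> \<psi> s" using u st by (intro mono_onD[OF mono]) auto
      ultimately show "1 / \<psi> s \<le> 1 / \<psi> u" by (simp add: frac_le)
    qed (use st in auto)
    finally have "(s - t) * (1 / \<psi> s) \<le> \<Phi> s - \<Phi> t" using split by simp
    moreover have "\<psi> s > 0" using st by (intro pos) auto
    ultimately show "s - t \<le> \<psi> s * (\<Phi> s - \<Phi> t)" by (simp add: field_simps)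
  qed
  show "0 \<le> \<Phi> s" if "s < \<eta>" for s
    unfolding \<Phi>_def set_lebesgue_integral_def
    using that pos by (intro integral_nonneg_AE AE_I2) (auto simp: indicator_def less_imp_le)
  assume \<eta>: "\<eta> > 0"
  have lim: "(\<lambda>n. \<eta> / real (n + 2)) \<longlonglongrightarrow> 0"
    using LIMSEQ_ignore_initial_segment[OF lim_const_over_n, of \<eta> 2] by simp
  have "\<exists>n. t \<notin> {0<..\<eta> / real (n + 2)}" for t
  proof (cases "t > 0")
    case True
    then obtain n where "\<eta> / real (n + 2) < t"
      using eventually_happens[OF order_tendstoD(2)[OF lim True]] by auto
    then show ?thesis by (auto intro: exI[of _ n])
  qed auto
  then have empty: "(\<Inter>n. {0<..\<eta> / real (n + 2)}) = {}" by blast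
  have "decseq (\<lambda>n. {0<..\<eta> / real (n + 2)})"
  proof (rule decseq_SucI)
    fix n
    have "\<eta> / real (Suc n + 2) \<le> \<eta> / real (n + 2)" using \<eta> by (intro divide_left_mono) auto
    then show "{0<..\<eta> / real (Suc n + 2)} \<subseteq> {0<..\<eta> / real (n + 2)}" by auto
  qed
  moreover have "set_integrable lborel {0<..\<eta> / real (0 + 2)} (\<lambda>t. 1 / \<psi> t)"
    using \<eta> by (intro sub) auto
  ultimately have "(\<lambda>n. \<Phi> (\<eta> / real (n + 2)))
      \<longlonglongrightarrow> (LINT t:(\<Inter>n. {0<..\<eta> / real (n + 2)})|lborel. 1 / \<psi> t)"
    unfolding \<Phi>_def by (intro set_integral_cont_down) auto
  then show "(\<lambda>n. \<Phi> (\<eta> / real (n + 2))) \<longlonglongrightarrow> 0"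
    unfolding empty set_lebesgue_integral_def by simp
qed

text \<open>
  The tangent inequality of the concave function \<open>s powr (1 - q)\<close>, obtained here from Young's
  inequality. This \<open>\<Phi>\<close> is an antiderivative of \<open>1 / (M * s powr q)\<close> in closed form, which the
  rates need.
\<close>

lemma power_desingularizes:
  fixes M q :: real
  assumes M: "M > 0" and q: "0 < q" "q < 1" and \<psi>: "\<And>t. t > 0 \<Longrightarrow> \<psi> t = M * t powr q"
  shows "desingularizes (\<lambda>s. s powr (1 - q) / (M * (1 - q))) \<psi> \<eta>"
  unfolding desingularizes_def
proof (intro allI impI, elim conjE)
  fix s t :: real assume st: "0 < t" "t \<le> s" "s < \<eta>"
  have "t powr (1 - q) * s powr q \<le> (1 - q) * t + q * s"
    using st q by (intro Youngs_inequality_0) auto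
  moreover have "s powr (1 - q) * s powr q = s"
    using st by (simp flip: powr_add)
  ultimately have "(1 - q) * (s - t) \<le> s powr q * (s powr (1 - q) - t powr (1 - q))"
    by (simp add: algebra_simps)
  then have "s - t \<le> s powr q * (s powr (1 - q) - t powr (1 - q)) / (1 - q)"
    using q by (simp add: pos_le_divide_eq mult.commute)
  also have "\<dots> = M * s powr q * (s powr (1 - q) / (M * (1 - q)) - t powr (1 - q) / (M * (1 - q)))"
    using M by (simp flip: diff_divide_distrib)
  finally show "s - t \<le> \<psi> s * (s powr (1 - q) / (M * (1 - q)) - t powr (1 - q) / (M * (1 - q)))"
    using \<psi>[of s] st by simp
qed

text \<open>
  The bound that telescopes: \<open>v\<close> and \<open>v'\<close> stand for the value gaps before and after a step of
  length \<open>s\<close>, and \<open>G\<close> for the gradient norm before it. The factor \<open>\<psi> v\<close> appears on both sides of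
  the estimate and cancels.
\<close>

lemma kl_step_length:
  assumes des: "desingularizes \<Phi> \<psi> \<eta>" and c: "c > 0"
    and v: "0 < v'" "v < \<eta>" and kl: "0 < \<psi> v" "\<psi> v \<le> G"
    and G: "G * s \<le> c * (v - v')" and s: "0 \<le> s"
  shows "v' \<le> v" and "s \<le> c * \<Phi> v - c * \<Phi> v'"
proof -
  have "0 \<le> G * s" using kl s by simp
  then have "0 \<le> c * (v - v')" using G by linarith
  then show le: "v' \<le> v" using c by (simp add: zero_le_mult_iff)
  have "\<psi> v * s \<le> G * s" using kl s by (intro mult_right_mono) auto
  also note G
  also have "c * (v - v') \<le> c * (\<psi> v * (\<Phi> v - \<Phi> v'))"
    using des le v c unfolding desingularizes_def by (intro mult_left_mono) auto
  also have "\<dots> = \<psi> v * (c * \<Phi> v - c * \<Phi> v')" by (simp add: algebra_simps)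
  finally show "s \<le> c * \<Phi> v - c * \<Phi> v'" using kl by simp
qed

section \<open>Convergence of descent sequences\<close>

text \<open>
  \<open>W k\<close> bounds the length of the path from \<open>x k\<close> on. Besides the convergence, this gives the
  distance to the limit, from which the rates of the iterates are read off.
\<close>

lemma convergent_of_telescoping_steps:
  fixes x :: "nat \<Rightarrow> 'a::banach"
  assumes step: "\<And>k. k \<ge> N \<Longrightarrow> norm (x (Suc k) - x k) \<le> W k - W (Suc k)"
    and W: "\<And>k. k \<ge> N \<Longrightarrow> 0 \<le> W k"
  obtains l where "x \<longlonglongrightarrow> l" and "\<And>k. k \<ge> N \<Longrightarrow> norm (x k - l) \<le> W k"
proof -
  have tele: "norm (x m - x k) \<le> W k - W m" if "k \<ge> N" "k \<le> m" for k m
    using that(2)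
  proof (induction m rule: nat_induct_at_least)
    case (Suc m)
    have "norm (x (Suc m) - x k) \<le> norm (x (Suc m) - x m) + norm (x m - x k)"
      using norm_triangle_ineq[of "x (Suc m) - x m" "x m - x k"] by simp
    with Suc step[of m] that(1) show ?case by simp
  qed simp
  have "decseq (\<lambda>n. W (n + N))"
    by (rule decseq_SucI) (use step in \<open>smt (verit, best) add_Suc le_add2 norm_ge_zero\<close>)
  moreover have "\<And>n. 0 \<le> W (n + N)" using W by simp
  ultimately obtain w where "(\<lambda>n. W (n + N)) \<longlonglongrightarrow> w"
    using decseq_convergent by blast
  then have w: "W \<longlonglongrightarrow> w" by (rule LIMSEQ_offset)
  then have "Cauchy W" by (rule LIMSEQ_imp_Cauchy)
  have "Cauchy x"
  proof (rule CauchyI')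
    fix e :: real assume "e > 0"
    then obtain K where K: "\<And>m n. m \<ge> K \<Longrightarrow> n \<ge> K \<Longrightarrow> norm (W m - W n) < e"
      using CauchyD[OF \<open>Cauchy W\<close>] by blast
    have "dist (x m) (x n) < e" if "m \<ge> max K N" "n > m" for m n
      using tele[of m n] K[of m n] that by (simp add: dist_norm norm_minus_commute)
    then show "\<exists>M. \<forall>m\<ge>M. \<forall>n>m. dist (x m) (x n) < e" by blast
  qed
  then obtain l where l: "x \<longlonglongrightarrow> l"
    using Cauchy_convergent convergent_def by blast
  have "norm (x k - l) \<le> W k" if k: "k \<ge> N" for k
  proof (rule tendsto_upperbound)
    show "(\<lambda>m. norm (x k - x m)) \<longlonglongrightarrow> norm (x k - l)"
      by (intro tendsto_intros l)
    show "\<forall>\<^sub>F m in sequentially. norm (x k - x m) \<le> W k"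
      using eventually_ge_at_top[of k]
    proof eventually_elim
      case (elim m)
      then show ?case using tele[OF k, of m] W[of m] k by (simp add: norm_minus_commute)
    qed
  qed simp
  with l show ?thesis by (rule that)
qed

text \<open>
  The invariant is \<open>norm (x k - z) + c * \<Phi> (f (x k) - f z) < \<rho> / 2\<close>: what a step adds to the
  distance, it takes at least off the second summand. The step bound requires that the new value lies
  above \<open>f z\<close>, hence that the new point lies in the ball of radius \<open>\<rho>\<close>; this comes from
  \<open>short\<close>, and it is the reason for the factor \<open>1 / 2\<close>.
\<close>

lemma kl_descent_trapped:
  fixes f :: "'a::real_normed_vector \<Rightarrow> real" and gf :: "'a \<Rightarrow> 'b::real_normed_vector"
  assumes des: "desingularizes \<Phi> \<psi> \<eta>" and \<Phi>: "\<And>s. s < \<eta> \<Longrightarrow> 0 \<le> \<Phi> s" and c: "c > 0"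
    and \<psi>: "\<And>t. t \<in> {0<..<\<eta>} \<Longrightarrow> \<psi> t > 0"
    and kl: "\<And>y. y \<in> ball z \<rho> \<Longrightarrow> f z < f y \<Longrightarrow> f y < f z + \<eta> \<Longrightarrow> \<psi> (f y - f z) \<le> norm (gf y)"
    and above: "\<And>k. k \<ge> 1 \<Longrightarrow> x k \<in> ball z \<rho> \<Longrightarrow> f z < f (x k)"
    and descent: "\<And>k. k \<ge> 1 \<Longrightarrow> norm (gf (x k)) * norm (x (Suc k) - x k) \<le> c * (f (x k) - f (x (Suc k)))"
    and short: "\<And>k. k \<ge> 1 \<Longrightarrow> norm (x (Suc k) - x k) \<le> norm (x k - z)"
    and start: "norm (x 1 - z) + c * \<Phi> (f (x 1) - f z) < \<rho> / 2" "f (x 1) < f z + \<eta>"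
    and k: "k \<ge> 1"
  shows "x k \<in> ball z (\<rho> / 2)" and "f z < f (x k)" and "f (x k) < f z + \<eta>"
proof -
  have near: "x k \<in> ball z (\<rho> / 2) \<and> f z < f (x k)"
    if k: "k \<ge> 1" and I: "norm (x k - z) + c * \<Phi> (f (x k) - f z) < \<rho> / 2" "f (x k) < f z + \<eta>" for k
  proof -
    have "0 \<le> c * \<Phi> (f (x k) - f z)" using c \<Phi> I(2) by simp
    then have "norm (x k - z) < \<rho> / 2" using I(1) by linarith
    moreover from this have "norm (x k - z) < \<rho>" using norm_ge_zero[of "x k - z"] by linarith
    ultimately show ?thesis using above[OF k] by (simp add: dist_norm norm_minus_commute)
  qed
  have "norm (x k - z) + c * \<Phi> (f (x k) - f z) < \<rho> / 2 \<and> f (x k) < f z + \<eta>"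
    using k
  proof (induction k rule: nat_induct_at_least)
    case base
    show ?case using start by simp
  next
    case (Suc k)
    then have k: "x k \<in> ball z (\<rho> / 2)" "f z < f (x k)" using near[of k] by auto
    have tri: "norm (x (Suc k) - z) \<le> norm (x (Suc k) - x k) + norm (x k - z)"
      using norm_triangle_ineq[of "x (Suc k) - x k" "x k - z"] by simp
    then have "x (Suc k) \<in> ball z \<rho>"
      using short[of k] Suc k by (simp add: dist_norm norm_minus_commute)
    then have pos: "f z < f (x (Suc k))" using above[of "Suc k"] by simp
    have "x k \<in> ball z \<rho>" using k zero_le_dist[of z "x k"] by (simp only: mem_ball)
    then have "\<psi> (f (x k) - f z) \<le> norm (gf (x k))" using kl k Suc by simp
    moreover have "\<psi> (f (x k) - f z) > 0" using \<psi> k Suc by simp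
    ultimately have "f (x (Suc k)) - f z \<le> f (x k) - f z"
      "norm (x (Suc k) - x k) \<le> c * \<Phi> (f (x k) - f z) - c * \<Phi> (f (x (Suc k)) - f z)"
      using kl_step_length[OF des c, of "f (x (Suc k)) - f z" "f (x k) - f z" "norm (gf (x k))"
          "norm (x (Suc k) - x k)"] descent[of k] pos Suc by auto
    then show ?case using tri Suc by linarith
  qed
  with near[OF k] show "x k \<in> ball z (\<rho> / 2)" "f z < f (x k)" "f (x k) < f z + \<eta>" by auto
qed

text \<open>
  The steps are summable, so the iterates converge; the decreases of \<open>f\<close> then tend to 0 and force
  the gradient to vanish at the limit. A limit with value above \<open>f z\<close> would contradict the
  inequality for \<open>\<psi>\<close>, by which the gradient there is nonzero.
\<close>

lemma kl_descent_converges: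
  fixes f :: "'a::banach \<Rightarrow> real" and gf :: "'a \<Rightarrow> 'b::real_normed_vector"
  assumes des: "desingularizes \<Phi> \<psi> \<eta>" and \<Phi>: "\<And>s. s < \<eta> \<Longrightarrow> 0 \<le> \<Phi> s" and c: "c > 0" and b: "b > 0"
    and cont: "continuous_on UNIV f" "continuous_on UNIV gf"
    and \<psi>: "\<And>t. t \<in> {0<..<\<eta>} \<Longrightarrow> \<psi> t > 0"
    and kl: "\<And>y. y \<in> ball z \<rho> \<Longrightarrow> f z < f y \<Longrightarrow> f y < f z + \<eta> \<Longrightarrow> \<psi> (f y - f z) \<le> norm (gf y)"
    and trapped: "\<And>k. k \<ge> 1 \<Longrightarrow> x k \<in> ball z (\<rho> / 2) \<and> f z < f (x k) \<and> f (x k) < f z + \<eta>"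
    and descent: "\<And>k. k \<ge> 1 \<Longrightarrow> norm (gf (x k)) * norm (x (Suc k) - x k) \<le> c * (f (x k) - f (x (Suc k)))"
    and decrease: "\<And>k. k \<ge> 1 \<Longrightarrow> b * (norm (gf (x k)))\<^sup>2 \<le> f (x k) - f (x (Suc k))"
  obtains l where "x \<longlonglongrightarrow> l" "l \<in> ball z \<rho>" "f l = f z" "gf l = 0"
proof -
  have \<rho>: "\<rho> > 0" using trapped[of 1] zero_le_dist[of z "x 1"] by (simp only: mem_ball) linarith
  have inball: "x k \<in> ball z \<rho>" if "k \<ge> 1" for k using trapped[OF that] \<rho> by auto
  have "norm (x (Suc k) - x k) \<le> c * \<Phi> (f (x k) - f z) - c * \<Phi> (f (x (Suc k)) - f z)"
    if k: "k \<ge> 1" for k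
    by (rule kl_step_length(2)[OF des c, where G = "norm (gf (x k))"])
      (use trapped[OF k] trapped[of "Suc k"] \<psi> kl[OF inball[OF k]] descent[OF k] in auto)
  moreover have "0 \<le> c * \<Phi> (f (x k) - f z)" if "k \<ge> 1" for k
    using trapped[OF that] c by (intro mult_nonneg_nonneg \<Phi>) auto
  ultimately obtain l where l: "x \<longlonglongrightarrow> l"
    by (rule convergent_of_telescoping_steps[of 1 x "\<lambda>k. c * \<Phi> (f (x k) - f z)"])
  have fl: "(\<lambda>k. f (x k)) \<longlonglongrightarrow> f l" and gl: "(\<lambda>k. gf (x k)) \<longlonglongrightarrow> gf l"
    using cont l by (auto intro: continuous_on_tendsto_compose)
  have "dist z l \<le> \<rho> / 2"
    by (rule tendsto_upperbound[of "\<lambda>k. dist z (x k)" _ sequentially])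
      (use l trapped in \<open>force intro: tendsto_dist eventually_sequentiallyI[of 1] less_imp_le\<close>)+
  then have lb: "l \<in> ball z \<rho>" using \<rho> by simp
  have "gf l = 0"
  proof -
    have "(\<lambda>k. b * (norm (gf (x k)))\<^sup>2) \<longlonglongrightarrow> b * (norm (gf l))\<^sup>2"
      by (intro tendsto_intros gl)
    moreover have "(\<lambda>k. f (x k) - f (x (Suc k))) \<longlonglongrightarrow> f l - f l"
      by (intro tendsto_intros fl LIMSEQ_Suc[OF fl])
    ultimately have "b * (norm (gf l))\<^sup>2 \<le> f l - f l"
      by (rule LIMSEQ_le) (use decrease in blast)
    then show ?thesis using b by (simp add: mult_le_0_iff)
  qed
  have mono: "f (x (Suc k)) \<le> f (x k)" if "k \<ge> 1" for k
  proof -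
    have "0 \<le> b * (norm (gf (x k)))\<^sup>2" using b by simp
    then show ?thesis using decrease[OF that] by linarith
  qed
  have ge: "f z \<le> f l"
    by (rule LIMSEQ_le_const[OF fl]) (use trapped less_imp_le in blast)
  have "f (x k) \<le> f (x 1)" if "k \<ge> 1" for k
    using that
  proof (induction k rule: nat_induct_at_least)
    case (Suc k)
    then show ?case using mono[of k] by simp
  qed simp
  then have "f l \<le> f (x 1)" by (intro LIMSEQ_le_const2[OF fl]) blast
  then have lt: "f l < f z + \<eta>" using trapped[of 1] by simp
  have "f l = f z"
  proof (rule ccontr)
    assume "f l \<noteq> f z"
    then have "f z < f l" using ge by simp
    then have "0 < \<psi> (f l - f z)" "\<psi> (f l - f z) \<le> norm (gf l)"
      using \<psi> kl[OF lb] lt by auto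
    then show False using \<open>gf l = 0\<close> by simp
  qed
  with l lb \<open>gf l = 0\<close> show ?thesis by (intro that)
qed

section \<open>Rates for power functions\<close>

text \<open>
  Once \<open>v k < 1\<close>, the power satisfies \<open>v k powr p \<ge> v k\<close>, and the recursion becomes a contraction.
\<close>

lemma linear_decay_of_power_recursion:
  fixes v :: "nat \<Rightarrow> real"
  assumes pos: "\<And>k. k \<ge> N \<Longrightarrow> v k > 0" and lim: "v \<longlonglongrightarrow> 0"
    and rec: "\<And>k. k \<ge> N \<Longrightarrow> a * v k powr p \<le> v k - v (Suc k)"
    and a: "a > 0" and p: "p \<le> 1"
  shows "converges_linearly v 0"
proof -
  have "\<forall>\<^sub>F k in sequentially. v k < 1 \<and> k \<ge> N"
    using order_tendstoD(2)[OF lim, of 1] eventually_ge_at_top[of N] by (auto elim: eventually_conj)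
  then obtain K where K: "\<And>k. k \<ge> K \<Longrightarrow> v k < 1 \<and> k \<ge> N"
    unfolding eventually_sequentially by blast
  \<comment> \<open>The cap \<open>1 / 2\<close> keeps the contraction factor positive.\<close>
  define \<rho> where "\<rho> = 1 - min a (1 / 2)"
  have \<rho>: "0 < \<rho>" "\<rho> < 1" using a by (auto simp: \<rho>_def)
  have contr: "v (Suc k) \<le> \<rho> * v k" if k: "k \<ge> K" for k
  proof -
    have v: "0 < v k" "v k < 1" using K[OF k] pos by auto
    have "v k powr 1 \<le> v k powr p"
      using v p by (intro powr_mono') auto
    then have "min a (1 / 2) * v k \<le> a * v k powr p"
      using v a by (intro mult_mono) auto
    then show ?thesis using rec[of k] K[OF k] by (simp add: \<rho>_def algebra_simps)
  qed
  have "v k \<le> v K * \<rho> ^ (k - K)" if "k \<ge> K" for k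
    using that
  proof (induction k rule: nat_induct_at_least)
    case (Suc k)
    have "v (Suc k) \<le> \<rho> * v k" using contr Suc by simp
    also have "\<dots> \<le> \<rho> * (v K * \<rho> ^ (k - K))" using Suc \<rho> by (intro mult_left_mono) auto
    also have "\<dots> = v K * \<rho> ^ (Suc k - K)" using Suc by (simp add: Suc_diff_le)
    finally show ?case .
  qed simp
  moreover have "\<rho> ^ (k - K) = \<rho> ^ k / \<rho> ^ K" if "k \<ge> K" for k
    using that \<rho> by (simp add: power_diff)
  ultimately have "\<forall>k\<ge>K. norm (v k - 0) \<le> v K / \<rho> ^ K * \<rho> ^ k"
    using pos K by (auto simp: less_imp_le abs_of_pos)
  then have "\<forall>\<^sub>F k in sequentially. norm (v k - 0) \<le> v K / \<rho> ^ K * \<rho> ^ k"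
    unfolding eventually_sequentially by blast
  moreover have "v K / \<rho> ^ K > 0" using pos K[of K] \<rho> by simp
  ultimately show ?thesis unfolding converges_linearly_def using \<rho> by blast
qed

text \<open>
  The recursion is a discrete form of \<open>v' = - a * v powr (1 + p)\<close>, whose solutions have
  \<open>v powr (- p)\<close> growing at the constant speed \<open>p * a\<close>. Convexity of \<open>u powr (- p)\<close>, applied to the
  ratio \<open>u\<close> of successive terms, shows that each step also increases \<open>v k powr (- p)\<close> by at least
  \<open>p * a\<close>.
\<close>

lemma sublinear_decay_of_power_recursion:
  fixes v :: "nat \<Rightarrow> real"
  assumes pos: "\<And>k. k \<ge> 1 \<Longrightarrow> v k > 0"
    and rec: "\<And>k. k \<ge> 1 \<Longrightarrow> a * v k powr (1 + p) \<le> v k - v (Suc k)"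
    and a: "a > 0" and p: "p > 0"
  obtains c where "c > 0" and "\<And>k. k \<ge> 2 \<Longrightarrow> v k \<le> c * real k powr (- (1 / p))"
proof -
  have incr: "v k powr (- p) + p * a \<le> v (Suc k) powr (- p)" if k: "k \<ge> 1" for k
  proof -
    define u where "u = v (Suc k) / v k"
    have v: "v k > 0" "v (Suc k) > 0" using pos k by auto
    then have u: "u > 0" by (simp add: u_def)
    have "a * v k powr p * v k \<le> (1 - u) * v k"
      using rec[OF k] v by (simp add: u_def powr_add algebra_simps)
    then have 1: "a * v k powr p \<le> 1 - u" using v by simp
    have "ln u \<le> u - 1" using u ln_le_minus_one by blast
    then have "p * (1 - u) \<le> p * - ln u" using p by (intro mult_left_mono) auto
    also have "\<dots> \<le> u powr (- p) - 1"
      using exp_ge_add_one_self[of "p * - ln u"] u by (simp add: powr_def)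
    finally have "1 + p * (a * v k powr p) \<le> u powr (- p)"
      using mult_left_mono[OF 1, of p] p by linarith
    then have "v k powr (- p) * (1 + p * (a * v k powr p)) \<le> v k powr (- p) * u powr (- p)"
      by (intro mult_left_mono) auto
    moreover have "v k powr (- p) * u powr (- p) = v (Suc k) powr (- p)"
      using v by (simp add: u_def flip: powr_mult)
    moreover have "v k powr (- p) * v k powr p = 1"
      using v by (simp flip: powr_add)
    ultimately show ?thesis by (simp add: algebra_simps)
  qed
  have lower: "p * a * (real k - 1) \<le> v k powr (- p)" if "k \<ge> 1" for k
    using that
  proof (induction k rule: nat_induct_at_least)
    case (Suc k)
    then show ?case using incr[of k] by (simp add: algebra_simps)
  qed simp
  have "v k \<le> (p * a / 2) powr (- (1 / p)) * real k powr (- (1 / p))" if k: "k \<ge> 2" for k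
  proof -
    \<comment> \<open>The sequence starts at index 1, so only \<open>k - 1\<close> steps have been made; \<open>k - 1 \<ge> k / 2\<close> from 2 on.\<close>
    have "p * a / 2 * real k \<le> p * a * (real k - 1)"
      using k p a by (simp add: field_simps)
    also have "\<dots> \<le> v k powr (- p)" using lower k by simp
    finally have "(v k powr (- p)) powr (- (1 / p)) \<le> (p * a / 2 * real k) powr (- (1 / p))"
      using k p a by (intro powr_mono2') auto
    moreover have "(v k powr (- p)) powr (- (1 / p)) = v k"
      using pos[of k] k p by (simp add: powr_powr)
    moreover have "(p * a / 2 * real k) powr (- (1 / p))
        = (p * a / 2) powr (- (1 / p)) * real k powr (- (1 / p))"
      using p a by (intro powr_mult)
    ultimately show ?thesis by simp
  qed
  moreover have "(p * a / 2) powr (- (1 / p)) > 0" using p a by simp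
  ultimately show ?thesis using that by blast
qed

lemma converges_linearly_of_powr_bound:
  assumes lin: "converges_linearly v 0" and s: "s > 0" and K: "K > 0"
    and v: "\<And>k. k \<ge> N \<Longrightarrow> 0 \<le> v k"
    and bound: "\<And>k. k \<ge> N \<Longrightarrow> norm (y k - l) \<le> K * v k powr s"
  shows "converges_linearly y l"
proof -
  obtain c \<rho> where c: "c > 0" and \<rho>: "0 < \<rho>" "\<rho> < 1"
    and ev: "\<forall>\<^sub>F k in sequentially. norm (v k - 0) \<le> c * \<rho> ^ k"
    using lin unfolding converges_linearly_def by blast
  have "\<forall>\<^sub>F k in sequentially. norm (y k - l) \<le> (K * c powr s) * (\<rho> powr s) ^ k"
    using ev eventually_ge_at_top[of N]
  proof eventually_elim
    case (elim k)
    have "v k powr s \<le> (c * \<rho> ^ k) powr s"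
      using elim v[of k] s by (intro powr_mono2) auto
    also have "\<dots> = c powr s * (\<rho> powr s) ^ k"
      using c \<rho> by (simp add: powr_mult powr_power powr_powr mult.commute flip: powr_realpow)
    finally have "K * v k powr s \<le> K * (c powr s * (\<rho> powr s) ^ k)"
      using K by (intro mult_left_mono) auto
    then show ?case using bound[of k] elim by simp
  qed
  moreover have "0 < \<rho> powr s" "\<rho> powr s < 1"
    using \<rho> s powr_less_mono2[of s \<rho> 1] by auto
  moreover have "K * c powr s > 0" using K c by simp
  ultimately show ?thesis unfolding converges_linearly_def by blast
qed

text \<open>
  Two consequences of the inequality for \<open>M * t powr q\<close> are combined. With sufficient decrease it
  gives a recursion for \<open>v\<close> alone, hence the rate of \<open>v\<close>; with strong descent it bounds the
  remaining length of the trajectory by a multiple of \<open>v k powr (1 - q)\<close>, which transfers the rate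
  to the iterates and, by the Lipschitz bound, to the gradients.
\<close>

lemma power_kl_rates:
  fixes x :: "nat \<Rightarrow> 'a::banach" and gf :: "'a \<Rightarrow> 'b::real_normed_vector" and v :: "nat \<Rightarrow> real"
  assumes M: "M > 0" and q: "0 < q" "q < 1"
    and pos: "\<And>k. k \<ge> 1 \<Longrightarrow> v k > 0"
    and kl: "\<And>k. k \<ge> 1 \<Longrightarrow> M * v k powr q \<le> norm (gf (x k))"
    and descent: "\<And>k. k \<ge> 1 \<Longrightarrow> norm (gf (x k)) * norm (x (Suc k) - x k) \<le> c * (v k - v (Suc k))"
    and decrease: "\<And>k. k \<ge> 1 \<Longrightarrow> b * (norm (gf (x k)))\<^sup>2 \<le> v k - v (Suc k)"
    and c: "c > 0" and b: "b > 0" and lim: "x \<longlonglongrightarrow> l" "v \<longlonglongrightarrow> 0"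
    and lip: "L-lipschitz_on UNIV gf" "L > 0" and crit: "gf l = 0"
  shows "q \<le> 1 / 2 \<Longrightarrow> converges_linearly x l \<and> converges_linearly (\<lambda>k. gf (x k)) 0
      \<and> converges_linearly v 0"
    and "q > 1 / 2 \<Longrightarrow>
      (\<lambda>k. norm (x k - l)) \<in> O(\<lambda>k. real k powr (- ((1 - q) / (2 * q - 1)))) \<and>
      (\<lambda>k. norm (gf (x k))) \<in> O(\<lambda>k. real k powr (- ((1 - q) / (2 * q - 1)))) \<and>
      v \<in> O(\<lambda>k. real k powr (- (1 / (2 * q - 1))))"
proof -
  define \<Phi> where "\<Phi> = (\<lambda>s. s powr (1 - q) / (M * (1 - q)))"
  have des: "desingularizes \<Phi> (\<lambda>t. M * t powr q) \<eta>" for \<eta>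
    unfolding \<Phi>_def using M q by (intro power_desingularizes) auto
  have "norm (x (Suc k) - x k) \<le> c * \<Phi> (v k) - c * \<Phi> (v (Suc k))" if k: "k \<ge> 1" for k
    \<comment> \<open>The power function desingularizes on every interval; \<open>v k + 1\<close> is some bound above \<open>v k\<close>.\<close>
    using kl_step_length(2)[OF des[of "v k + 1"] c _ _ _ kl[OF k] descent[OF k]]
      pos[of k] pos[of "Suc k"] k M by simp
  moreover have "0 \<le> c * \<Phi> (v k)" for k
    using c M q by (simp add: \<Phi>_def)
  ultimately obtain l' where l': "x \<longlonglongrightarrow> l'" "\<And>k. k \<ge> 1 \<Longrightarrow> norm (x k - l') \<le> c * \<Phi> (v k)"
    using convergent_of_telescoping_steps[of 1 x "\<lambda>k. c * \<Phi> (v k)"] by blast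
  have "l' = l" using l'(1) lim(1) by (rule LIMSEQ_unique)
  define K where "K = c / (M * (1 - q))"
  have K: "K > 0" using c M q by (simp add: K_def)
  have bx: "norm (x k - l) \<le> K * v k powr (1 - q)" if "k \<ge> 1" for k
    using l'(2)[OF that] \<open>l' = l\<close> by (simp add: \<Phi>_def K_def)
  have bg: "norm (gf (x k) - 0) \<le> (L * K) * v k powr (1 - q)" if "k \<ge> 1" for k
  proof -
    have "norm (gf (x k)) \<le> L * norm (x k - l)"
      using lipschitz_onD[OF lip(1), of "x k" l] crit by (simp add: dist_norm)
    also have "\<dots> \<le> L * (K * v k powr (1 - q))"
      using bx[OF that] lip by (intro mult_left_mono) auto
    finally show ?thesis by (simp add: mult.assoc)
  qed
  have rec: "(b * M\<^sup>2) * v k powr (2 * q) \<le> v k - v (Suc k)" if k: "k \<ge> 1" for k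
  proof -
    have "(M * v k powr q)\<^sup>2 \<le> (norm (gf (x k)))\<^sup>2"
      using kl[OF k] M by (intro power_mono) auto
    moreover have "(v k powr q)\<^sup>2 = v k powr (2 * q)"
      by (simp add: power2_eq_square flip: powr_add)
    ultimately have "b * (M\<^sup>2 * v k powr (2 * q)) \<le> b * (norm (gf (x k)))\<^sup>2"
      using b by (intro mult_left_mono) (auto simp: power_mult_distrib)
    then show ?thesis using decrease[OF k] by (simp add: mult.assoc)
  qed
  have a: "b * M\<^sup>2 > 0" using b M by simp
  {
    assume "q \<le> 1 / 2"
    then have lin: "converges_linearly v 0"
      using linear_decay_of_power_recursion[of 1 v "b * M\<^sup>2" "2 * q"] pos lim(2) rec a by simp
    have "converges_linearly x l"
      using converges_linearly_of_powr_bound[OF lin _ K _ bx, of 1] q pos by (simp add: less_imp_le)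
    moreover have "converges_linearly (\<lambda>k. gf (x k)) 0"
      using converges_linearly_of_powr_bound[OF lin _ _ _ bg, of 1] q pos K lip(2) by (simp add: less_imp_le)
    ultimately show "converges_linearly x l \<and> converges_linearly (\<lambda>k. gf (x k)) 0
        \<and> converges_linearly v 0" using lin by simp
  next
    assume q2: "q > 1 / 2"
    define p where "p = 2 * q - 1"
    have p: "p > 0" "2 * q = 1 + p" using q2 by (auto simp: p_def)
    obtain C where C: "C > 0" "\<And>k. k \<ge> 2 \<Longrightarrow> v k \<le> C * real k powr (- (1 / p))"
      using sublinear_decay_of_power_recursion[of v "b * M\<^sup>2" p] pos rec a p by auto
    have big: "y \<in> O(\<lambda>k. real k powr (- ((1 - q) / p)))"
      if "B > 0" "\<And>k. k \<ge> 1 \<Longrightarrow> norm (y k) \<le> B * v k powr (1 - q)" for y :: "nat \<Rightarrow> real" and B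
    proof (rule bigoI)
      show "\<forall>\<^sub>F k in sequentially.
          norm (y k) \<le> (B * C powr (1 - q)) * norm (real k powr (- ((1 - q) / p)))"
        using eventually_ge_at_top[of 2]
      proof eventually_elim
        case (elim k)
        have "v k powr (1 - q) \<le> (C * real k powr (- (1 / p))) powr (1 - q)"
          using C(2)[OF elim] pos[of k] elim q by (intro powr_mono2) auto
        also have "\<dots> = C powr (1 - q) * real k powr (- ((1 - q) / p))"
          using C by (simp add: powr_mult powr_powr)
        finally have "B * v k powr (1 - q) \<le> B * (C powr (1 - q) * real k powr (- ((1 - q) / p)))"
          using that(1) by (intro mult_left_mono) auto
        then show ?case using that(2)[of k] elim by simp
      qed
    qed
    have "v \<in> O(\<lambda>k. real k powr (- (1 / p)))"
    proof (rule bigoI)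
      show "\<forall>\<^sub>F k in sequentially. norm (v k) \<le> C * norm (real k powr (- (1 / p)))"
        using eventually_ge_at_top[of 2]
      proof eventually_elim
        case (elim k)
        then show ?case using C(2)[of k] pos[of k] by simp
      qed
    qed
    moreover have "(\<lambda>k. norm (x k - l)) \<in> O(\<lambda>k. real k powr (- ((1 - q) / p)))"
      by (rule big[OF K]) (use bx in simp)
    moreover have "(\<lambda>k. norm (gf (x k))) \<in> O(\<lambda>k. real k powr (- ((1 - q) / p)))"
      by (rule big[of "L * K"]) (use bg K lip in simp_all)
    ultimately show "(\<lambda>k. norm (x k - l)) \<in> O(\<lambda>k. real k powr (- ((1 - q) / (2 * q - 1)))) \<and>
      (\<lambda>k. norm (gf (x k))) \<in> O(\<lambda>k. real k powr (- ((1 - q) / (2 * q - 1)))) \<and>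
      v \<in> O(\<lambda>k. real k powr (- (1 / (2 * q - 1))))"
      unfolding p_def by simp
  }
qed

section \<open>Convergence of the derivative-free method\<close>

theorem corollary6p3:
  fixes f :: "real ^ 'n \<Rightarrow> real" and gf :: "real ^ 'n \<Rightarrow> real ^ 'n"
    and xb :: "real ^ 'n" and \<Delta> :: real and \<psi> :: "real \<Rightarrow> real"
  assumes "C1_with_Lipschitz_gradient f gf"
    and "\<Delta> > 0"
    and "local_minimizer f xb"
    and "KL_property_with \<psi> f gf xb"
  shows "\<exists>\<xi>>0. \<forall>C'>0. \<forall>\<kappa>>0. \<exists>Cb>0. \<forall>G \<theta> \<mu> r x g i \<delta> C.
    global_approximation C' gf G \<and>
    DFC_run f G \<theta> \<mu> r \<kappa> x g i \<delta> C \<and>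
    x 1 \<in> ball xb \<xi> \<and> \<delta> 1 \<in> {0<..\<Delta>} \<and> C 1 \<ge> Cb \<and>
    (\<forall>k\<ge>1. gf (x k) \<noteq> 0) \<longrightarrow>
    (\<exists>xt. x \<longlonglongrightarrow> xt \<and> local_minimizer f xt \<and> f xt = f xb \<and>
      (\<forall>M q. M > 0 \<and> 0 < q \<and> q < 1 \<and> (\<forall>t>0. \<psi> t = M * t powr q) \<longrightarrow>
        (q \<le> 1 / 2 \<longrightarrow>
           converges_linearly x xt \<and>
           converges_linearly (\<lambda>k. gf (x k)) 0 \<and>
           converges_linearly (\<lambda>k. f (x k)) (f xb)) \<and>
        (q > 1 / 2 \<longrightarrow>
           (\<lambda>k. norm (x k - xt)) \<in> O(\<lambda>k. real k powr (- ((1 - q) / (2 * q - 1)))) \<and>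
           (\<lambda>k. norm (gf (x k))) \<in> O(\<lambda>k. real k powr (- ((1 - q) / (2 * q - 1)))) \<and>
           (\<lambda>k. f (x k) - f xb) \<in> O(\<lambda>k. real k powr (- ((2 - 2 * q) / (2 * q - 1)))))))"
proof -
  let ?rates = "\<lambda>x xt q.
        (q \<le> 1 / 2 \<longrightarrow>
           converges_linearly x xt \<and>
           converges_linearly (\<lambda>k. gf (x k)) 0 \<and>
           converges_linearly (\<lambda>k. f (x k)) (f xb)) \<and>
        (q > 1 / 2 \<longrightarrow>
           (\<lambda>k. norm (x k - xt)) \<in> O(\<lambda>k. real k powr (- ((1 - q) / (2 * q - 1)))) \<and>
           (\<lambda>k. norm (gf (x k))) \<in> O(\<lambda>k. real k powr (- ((1 - q) / (2 * q - 1)))) \<and>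
           (\<lambda>k. f (x k) - f xb) \<in> O(\<lambda>k. real k powr (- ((2 - 2 * q) / (2 * q - 1)))))"
  obtain L where grad: "\<And>x. GDERIV f x :> gf x" and cont_gf: "continuous_on UNIV gf"
    and L: "L > 0" and lip: "L-lipschitz_on UNIV gf"
    using assms(1) unfolding C1_with_Lipschitz_gradient_def by blast
  have cont_f: "continuous_on UNIV f"
    using grad by (auto simp: gderiv_def intro!: continuous_at_imp_continuous_on has_derivative_continuous)
  obtain \<epsilon> where \<epsilon>: "\<epsilon> > 0" and min: "\<And>y. y \<in> ball xb \<epsilon> \<Longrightarrow> f xb \<le> f y"
    using assms(3) unfolding local_minimizer_def by blast
  obtain \<eta> U where \<eta>: "\<eta> > 0" and U: "open U" "xb \<in> U"
    and \<psi>: "\<And>t. t \<in> {0<..<\<eta>} \<Longrightarrow> \<psi> t > 0" "mono_on {0<..<\<eta>} \<psi>"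
      "set_integrable lborel {0<..<\<eta>} (\<lambda>t. 1 / \<psi> t)"
    and klU: "\<And>y. y \<in> U \<Longrightarrow> f xb < f y \<Longrightarrow> f y < f xb + \<eta> \<Longrightarrow> \<psi> (f y - f xb) \<le> norm (gf y)"
    using assms(4) unfolding KL_property_with_def by metis
  obtain e where e: "e > 0" "ball xb e \<subseteq> U" using U open_contains_ball by blast
  \<comment> \<open>On the ball of radius \<open>\<rho>\<close>, both minimality of \<open>xb\<close> and the inequality for \<open>\<psi>\<close> are available.\<close>
  define \<rho> where "\<rho> = min \<epsilon> e"
  have \<rho>: "\<rho> > 0" using \<epsilon> e by (simp add: \<rho>_def)
  have kl: "\<psi> (f y - f xb) \<le> norm (gf y)"
    if "y \<in> ball xb \<rho>" "f xb < f y" "f y < f xb + \<eta>" for y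
    using klU e that by (auto simp: \<rho>_def)
  have local_min: "local_minimizer f y" if y: "y \<in> ball xb \<rho>" "f y = f xb" for y
  proof -
    obtain d where "d > 0" "ball y d \<subseteq> ball xb \<rho>"
      using openE[OF open_ball y(1)] by blast
    moreover have "ball xb \<rho> \<subseteq> ball xb \<epsilon>" by (rule subset_ball) (simp add: \<rho>_def)
    ultimately have "\<forall>w\<in>ball y d. f y \<le> f w" using min y(2) by (metis subsetD)
    with \<open>d > 0\<close> show ?thesis unfolding local_minimizer_def by blast
  qed
  \<comment> \<open>A point of the ball at the minimal level is a local minimizer, hence critical; so the
     noncritical iterates lie strictly above that level.\<close>
  have noncritical: "f xb < f y" if "y \<in> ball xb \<rho>" "gf y \<noteq> 0" for y
  proof -
    have "f xb \<le> f y" using min[of y] that(1) by (simp add: \<rho>_def)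
    moreover have "f y \<noteq> f xb"
      using local_min[OF that(1)] gradient_zero_at_local_minimizer[OF grad[of y]] that(2) by blast
    ultimately show ?thesis by simp
  qed
  define \<Phi> where "\<Phi> = (\<lambda>s. LINT t:{0<..s}|lborel. 1 / \<psi> t)"
  have des: "desingularizes \<Phi> \<psi> \<eta>" and \<Phi>: "\<And>s. s < \<eta> \<Longrightarrow> 0 \<le> \<Phi> s"
    and lim\<Phi>: "(\<lambda>n. \<Phi> (\<eta> / real (n + 2))) \<longlonglongrightarrow> 0"
    unfolding \<Phi>_def using integral_desingularizes[OF \<psi>] \<eta> by auto
  \<comment> \<open>Starting below the level \<open>s\<close> within distance \<open>\<rho> / 4\<close> makes the initial value of the trapping
     invariant smaller than \<open>\<rho> / 4 + 6 * (\<rho> / 24) = \<rho> / 2\<close>.\<close>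
  obtain n where n: "\<Phi> (\<eta> / real (n + 2)) < \<rho> / 24"
    using eventually_happens[OF order_tendstoD(2)[OF lim\<Phi>, of "\<rho> / 24"]] \<rho> by auto
  define s where "s = \<eta> / real (n + 2)"
  have s: "0 < s" "s < \<eta>" using \<eta> by (auto simp: s_def field_simps add_pos_nonneg)
  have "(f \<longlongrightarrow> f xb) (nhds xb)"
    using cont_f
    by (simp add: continuous_on_eq_continuous_at isCont_def tendsto_at_iff_tendsto_nhds)
  then have "\<forall>\<^sub>F y in nhds xb. f y < f xb + s"
    using s by (intro order_tendstoD(2)) auto
  then obtain \<xi>' where \<xi>': "\<xi>' > 0" "\<And>y. dist y xb < \<xi>' \<Longrightarrow> f y < f xb + s"
    unfolding eventually_nhds_metric by blast
  define \<xi> where "\<xi> = min (\<rho> / 4) \<xi>'"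
  have \<xi>: "\<xi> > 0" using \<rho> \<xi>' by (simp add: \<xi>_def)
  have run_converges: "\<exists>xt. x \<longlonglongrightarrow> xt \<and> local_minimizer f xt \<and> f xt = f xb \<and>
      (\<forall>M q. M > 0 \<and> 0 < q \<and> q < 1 \<and> (\<forall>t>0. \<psi> t = M * t powr q) \<longrightarrow> ?rates x xt q)"
    if approx: "global_approximation C' gf G" and run: "DFC_run f G \<theta> \<mu> r \<kappa> x g i \<delta> C"
      and x1: "x 1 \<in> ball xb \<xi>" and C1: "C 1 \<ge> max C' (2 * L * \<kappa>)"
      and nc: "\<And>k. k \<ge> 1 \<Longrightarrow> gf (x k) \<noteq> 0"
    for C' \<kappa> G \<theta> \<mu> r and x g :: "nat \<Rightarrow> real ^ 'n" and i \<delta> C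
  proof -
    have par: "\<kappa> > 0" "\<mu> > 2" "C 1 > 0" using run unfolding DFC_run_def by auto
    define t where "t = \<kappa> / C 1"
    have t: "t > 0" "2 * L * t \<le> 1" using par C1 by (auto simp: t_def field_simps)
    have LC: "L * \<kappa> \<le> C 1"
    proof -
      have "0 < L * \<kappa>" using L par by simp
      then show ?thesis using C1 by simp
    qed
    have step: "x (Suc k) = x k - t *\<^sub>R g k" "norm (g k - gf (x k)) \<le> norm (g k) / 2"
      if k: "k \<ge> 1" for k
    proof -
      have "C' \<le> C 1" using C1 by simp
      note acc = dfc_large_initial_C_accepts[OF grad lip approx run this LC k]
      show "x (Suc k) = x k - t *\<^sub>R g k" using acc(3) by (simp add: t_def)
      have "1 / \<mu> * norm (g k) \<le> 1 / 2 * norm (g k)"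
        using par by (intro mult_right_mono) (auto simp: field_simps)
      with acc(2) show "norm (g k - gf (x k)) \<le> norm (g k) / 2" by linarith
    qed
    have descent: "norm (gf (x k)) * norm (x (Suc k) - x k) \<le> 6 * (f (x k) - f (x (Suc k)))"
      and decrease: "t / 9 * (norm (gf (x k)))\<^sup>2 \<le> f (x k) - f (x (Suc k))"
      and short: "norm (x (Suc k) - x k) \<le> norm (x k - xb)" if k: "k \<ge> 1" for k
      using short_inexact_step_bounds[OF grad lip step(2)[OF k] t step(1)[OF k]]
        gradient_zero_at_local_minimizer[OF grad assms(3)] by auto
    have start: "norm (x 1 - xb) + 6 * \<Phi> (f (x 1) - f xb) < \<rho> / 2" "f (x 1) < f xb + \<eta>"
    proof -
      have d1: "dist xb (x 1) < \<rho> / 4" and f1: "f (x 1) < f xb + s"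
        using x1 \<xi>'(2)[of "x 1"] by (auto simp: \<xi>_def dist_commute)
      have "f xb < f (x 1)" using noncritical[of "x 1"] nc d1 \<rho> by simp
      then have "0 \<le> \<psi> s * (\<Phi> s - \<Phi> (f (x 1) - f xb))"
        using des f1 s unfolding desingularizes_def by (smt (verit, best))
      then have "\<Phi> (f (x 1) - f xb) \<le> \<Phi> s" using \<psi>(1)[of s] s by (simp add: zero_le_mult_iff)
      then show "norm (x 1 - xb) + 6 * \<Phi> (f (x 1) - f xb) < \<rho> / 2"
        using n d1 by (simp add: s_def dist_norm norm_minus_commute)
      show "f (x 1) < f xb + \<eta>" using f1 s by simp
    qed
    have trapped: "x k \<in> ball xb (\<rho> / 2) \<and> f xb < f (x k) \<and> f (x k) < f xb + \<eta>" if "k \<ge> 1" for k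
      using kl_descent_trapped[where f = f and gf = gf and x = x and c = 6, OF des \<Phi> _ \<psi>(1) kl
          noncritical[OF _ nc] descent short start that] by simp
    obtain xt where xt: "x \<longlonglongrightarrow> xt" "xt \<in> ball xb \<rho>" "f xt = f xb" "gf xt = 0"
      using kl_descent_converges[where f = f and gf = gf and x = x and z = xb and \<rho> = \<rho> and c = 6
          and b = "t / 9", OF des \<Phi> _ _ cont_f cont_gf \<psi>(1) kl trapped descent decrease] t by auto
    have "(\<lambda>k. f (x k)) \<longlonglongrightarrow> f xb"
      using continuous_on_tendsto_compose[OF cont_f xt(1)] xt(3) by simp
    then have limv: "(\<lambda>k. f (x k) - f xb) \<longlonglongrightarrow> 0" by (rule LIM_zero)
    have rates: "?rates x xt q"
      if M: "M > 0" and q: "0 < q" "q < 1" and \<psi>_eq: "\<And>t. t > 0 \<Longrightarrow> \<psi> t = M * t powr q" for M q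
    proof -
      have kl': "M * (f (x k) - f xb) powr q \<le> norm (gf (x k))" if "k \<ge> 1" for k
        using trapped[OF that] kl[of "x k"] \<psi>_eq[of "f (x k) - f xb"] \<rho> by auto
      have gap: "f (x k) - f xb > 0"
        and descent': "norm (gf (x k)) * norm (x (Suc k) - x k)
          \<le> 6 * ((f (x k) - f xb) - (f (x (Suc k)) - f xb))"
        and decrease': "t / 9 * (norm (gf (x k)))\<^sup>2
          \<le> (f (x k) - f xb) - (f (x (Suc k)) - f xb)" if "k \<ge> 1" for k
        using trapped[OF that] descent[OF that] decrease[OF that] by simp_all
      note R = power_kl_rates[where v = "\<lambda>k. f (x k) - f xb" and gf = gf and x = x and c = 6
          and b = "t / 9", OF M q gap kl' descent' decrease' _ _ xt(1) limv lip L xt(4)]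
      \<comment> \<open>The values decay like \<open>k powr (- (1 / (2 * q - 1)))\<close>, which is faster than claimed since
         \<open>2 - 2 * q < 1\<close>.\<close>
      have faster: "(\<lambda>k. real k powr (- (1 / (2 * q - 1)))) \<in> O(\<lambda>k. real k powr (- ((2 - 2 * q) / (2 * q - 1))))"
        if q2: "q > 1 / 2"
      proof (rule bigoI)
        show "\<forall>\<^sub>F k in sequentially. norm (real k powr (- (1 / (2 * q - 1))))
            \<le> 1 * norm (real k powr (- ((2 - 2 * q) / (2 * q - 1))))"
          using eventually_ge_at_top[of 1]
        proof eventually_elim
          case (elim k)
          have "(2 - 2 * q) / (2 * q - 1) \<le> 1 / (2 * q - 1)"
            using q2 by (intro divide_right_mono) auto
          then show ?case using elim by (simp add: powr_mono)
        qed
      qed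
      show ?thesis
      proof (intro conjI impI)
        assume "q \<le> 1 / 2"
        then have lin: "converges_linearly x xt \<and> converges_linearly (\<lambda>k. gf (x k)) 0
            \<and> converges_linearly (\<lambda>k. f (x k) - f xb) 0"
          by (intro R(1)) (use t in simp_all)
        then show "converges_linearly x xt" "converges_linearly (\<lambda>k. gf (x k)) 0" by auto
        show "converges_linearly (\<lambda>k. f (x k)) (f xb)"
          using lin unfolding converges_linearly_def by simp
      next
        assume q2: "q > 1 / 2"
        then have sub: "(\<lambda>k. norm (x k - xt)) \<in> O(\<lambda>k. real k powr (- ((1 - q) / (2 * q - 1)))) \<and>
            (\<lambda>k. norm (gf (x k))) \<in> O(\<lambda>k. real k powr (- ((1 - q) / (2 * q - 1)))) \<and>
            (\<lambda>k. f (x k) - f xb) \<in> O(\<lambda>k. real k powr (- (1 / (2 * q - 1))))"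
          by (intro R(2)) (use t in simp_all)
        then show "(\<lambda>k. norm (x k - xt)) \<in> O(\<lambda>k. real k powr (- ((1 - q) / (2 * q - 1))))"
          "(\<lambda>k. norm (gf (x k))) \<in> O(\<lambda>k. real k powr (- ((1 - q) / (2 * q - 1))))" by auto
        show "(\<lambda>k. f (x k) - f xb) \<in> O(\<lambda>k. real k powr (- ((2 - 2 * q) / (2 * q - 1))))"
          using sub faster[OF q2] landau_o.big_trans by blast
      qed
    qed
    show ?thesis
      by (rule exI[of _ xt], rule conjI[OF xt(1)], rule conjI[OF local_min[OF xt(2,3)]],
          rule conjI[OF xt(3)], intro allI impI, rule rates) blast+
  qed
  show ?thesis (is "\<exists>\<xi>>0. \<forall>C'>0. \<forall>\<kappa>>0. \<exists>Cb>0. ?all_runs \<xi> C' \<kappa> Cb")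
  proof (rule exI[of _ \<xi>], rule conjI[OF \<xi>], intro allI impI)
    fix C' \<kappa> :: real
    assume "C' > 0"
    then have "max C' (2 * L * \<kappa>) > 0" by simp
    moreover have "?all_runs \<xi> C' \<kappa> (max C' (2 * L * \<kappa>))"
      by (intro allI impI, elim conjE, rule run_converges) blast+
    ultimately show "\<exists>Cb>0. ?all_runs \<xi> C' \<kappa> Cb" by blast
  qed
qed

end
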